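(* Let $X$ be a separable infinite-dimensional complex Banach space and let $T$ be a bounded linear operator on $X$. If $T$ has a perfectly spanning set of eigenvectors associated to unimodular eigenvalues, then $T$ is frequently hypercyclic.
   Context: $\mathbb{T}=\{\lambda\in\mathbb{C} : |\lambda|=1\}$ is the unit circle. A bounded operator $T$ on $X$ has a perfectly spanning set of eigenvectors associated to unimodular eigenvalues if there exists a continuous (i.e. atomless) probability measure $\sigma$ on $\mathbb{T}$ such that for every $\sigma$-measurable subset $A$ of $\mathbb{T}$ with $\sigma(A)=1$, the linear span of $\bigcup_{\lambda\in A}\ker(T-\lambda)$ is dense in $X$. The operator $T$ is frequently hypercyclic if there exists $x\in X$ such that for every non-empty open subset $U$ of $X$ the set $\{n\geq 0 : T^n x\in U\}$ has positive lower density, where the lower density of $D\subseteq\mathbb{N}$ is $\liminf_{N\to\infty}\frac{1}{N}\#\{n\le N : n\in D\}$. *)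

theory Defs
  imports "HOL-Analysis.Analysis" "HOL-Probability.Probability_Measure"
begin

section \<open>Complex Banach spaces\<close>

text \<open>The scalar multiplication by complex numbers extends the real one, so every complex normed
  space is also a real normed space with the same norm and the same topology.\<close>

class scaleC = scaleR +
  fixes scaleC :: "complex \<Rightarrow> 'a \<Rightarrow> 'a" (infixr "*\<^sub>C" 75)
  assumes scaleR_scaleC: "r *\<^sub>R x = complex_of_real r *\<^sub>C x"

class complex_vector = scaleC + ab_group_add +
  assumes scaleC_add_right: "a *\<^sub>C (x + y) = a *\<^sub>C x + a *\<^sub>C y"
    and scaleC_add_left: "(a + b) *\<^sub>C x = a *\<^sub>C x + b *\<^sub>C x"
    and scaleC_scaleC: "a *\<^sub>C (b *\<^sub>C x) = (a * b) *\<^sub>C x"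
    and scaleC_one: "1 *\<^sub>C x = x"

class complex_normed_vector = complex_vector + real_normed_vector +
  assumes norm_scaleC: "norm (a *\<^sub>C x) = cmod a * norm x"

class cbanach = complex_normed_vector + complete_space

subclass (in cbanach) banach ..

instantiation complex :: cbanach
begin

definition scaleC_complex :: "complex \<Rightarrow> complex \<Rightarrow> complex" where
  "scaleC_complex a x = a * x"

instance
  by intro_classes (simp_all add: scaleC_complex_def scaleR_conv_of_real algebra_simps norm_mult)

end

global_interpretation complex_vector: vector_space "scaleC :: complex \<Rightarrow> 'a \<Rightarrow> 'a::complex_vector"
  defines cspan = complex_vector.span
  by unfold_locales (fact scaleC_add_right scaleC_add_left scaleC_scaleC scaleC_one)+

definition cfinite_dim :: "'a::complex_vector itself \<Rightarrow> bool" where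
  "cfinite_dim _ \<longleftrightarrow> (\<exists>B :: 'a set. finite B \<and> cspan B = UNIV)"

definition bounded_clinear :: "('a::complex_normed_vector \<Rightarrow> 'b::complex_normed_vector) \<Rightarrow> bool" where
  "bounded_clinear T \<longleftrightarrow>
     Vector_Spaces.linear scaleC scaleC T \<and> (\<exists>K. \<forall>x. norm (T x) \<le> norm x * K)"


section \<open>Perfectly spanning unimodular eigenvectors\<close>

abbreviation unit_circle :: "complex set" where
  "unit_circle \<equiv> sphere 0 1"

text \<open>A continuous measure is one that gives no mass to points.\<close>

definition continuous_prob_on_circle :: "complex measure \<Rightarrow> bool" where
  "continuous_prob_on_circle \<sigma> \<longleftrightarrow>
     sets \<sigma> = sets (restrict_space borel unit_circle) \<and> prob_space \<sigma> \<and>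
     (\<forall>z\<in>unit_circle. emeasure \<sigma> {z} = 0)"

text \<open>The \<open>\<sigma>\<close>-measurable sets are those of the completion of the Borel measure \<open>\<sigma>\<close>.\<close>

definition perfectly_spanning_unimodular :: "('a::complex_normed_vector \<Rightarrow> 'a) \<Rightarrow> bool" where
  "perfectly_spanning_unimodular T \<longleftrightarrow>
     (\<exists>\<sigma>. continuous_prob_on_circle \<sigma> \<and>
        (\<forall>A\<in>sets (completion \<sigma>). emeasure (completion \<sigma>) A = 1 \<longrightarrow>
           closure (cspan (\<Union>z\<in>A. {x. T x - z *\<^sub>C x = 0})) = UNIV))"


section \<open>Frequent hypercyclicity\<close>

definition lower_density :: "nat set \<Rightarrow> ereal" where
  "lower_density D = liminf (\<lambda>N. ereal (real (card {n. n \<le> N \<and> n \<in> D}) / real N))"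

definition frequently_hypercyclic :: "('a::topological_space \<Rightarrow> 'a) \<Rightarrow> bool" where
  "frequently_hypercyclic T \<longleftrightarrow>
     (\<exists>x. \<forall>U. open U \<and> U \<noteq> {} \<longrightarrow> lower_density {n. (T ^^ n) x \<in> U} > 0)"

end

theory Submission
  imports Defs
begin

text \<open>
  A frequently hypercyclic vector is built as a series of finite sums of unimodular eigenvectors.

  Two features of an orbit are played against each other. On the one hand, a finite sum of
  unimodular eigenvectors is almost periodic under \<open>T\<close>: whatever its orbit does once, it nearly
  repeats along a set of times of positive density. On the other hand, if \<open>u\<close> is a limit of
  eigenvectors with infinitely many different eigenvalues, then the average \<open>y\<close> of \<open>M\<close> such
  eigenvectors close to \<open>u\<close>, with distinct eigenvalues \<open>\<mu>\<close> ranging over a set \<open>S\<close>, is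
  itself close to \<open>u\<close>, whereas \<open>T\<^sup>n y\<close> is close to the multiple of \<open>u\<close> by
  \<open>(\<Sum>\<mu>\<in>S. \<mu>\<^sup>n) / M\<close>. The mean square of this factor over the times \<open>n\<close> is \<open>1 / M\<close>, by
  orthogonality of distinct characters. So \<open>T\<^sup>n y\<close> is small for all \<open>n\<close> outside a set of small
  density (\<open>accumulated_eigenvector_rarely_large_limit\<close>). The vectors that can be approximated by
  such \<open>y\<close> form a closed subspace.

  Continuity of the spanning measure enters only through its consequence that countably many
  eigenvalues can be discarded without losing density of the span. By separability, all but
  countably many eigenvalues have only eigenvectors that are limits as above
  (\<open>countable_few_nearby_eigenvalues\<close>), so the closed subspace is the whole space.

  The series is built step by step, with one step for each member of a countable family of target
  balls. Let \<open>z\<close> be the partial sum and \<open>w\<close> the centre of the current target. Pick \<open>y\<^sub>0\<close> close to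
  \<open>w - z\<close> with a rarely large orbit and add \<open>y = T\<^sup>m y\<^sub>0\<close> for a suitable \<open>m\<close>. For a return time
  \<open>k \<ge> m\<close> of both \<open>z\<close> and \<open>y\<^sub>0\<close>, the vector \<open>T\<^bsup>k - m\<^esup> (z + y)\<close> is close to \<open>z + y\<^sub>0\<close>, hence
  to \<open>w\<close>, if \<open>m\<close> is itself a return time of \<open>z\<close>; this gives a positive density of hits. Moreover
  \<open>m\<close> can be chosen so that the orbit of \<open>y\<close> is rarely large in every initial segment of the
  times, by the rising sun argument of \<open>sunset_points_frequent\<close>. These bounds in every initial
  segment add up over infinitely many steps, which bounds on the upper density alone would not.
  Hence all later steps together spoil only a small proportion of the hits of each target.
\<close>

section \<open>Times in the natural numbers\<close>

text \<open>Pigeonhole: the points \<open>(\<mu>\<^sup>n)\<^bsub>\<mu>\<in>F\<^esub>\<close> fall into finitely many cells of the torus, so one cell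
  collects at least the average number of times below \<open>N\<close>. Subtracting the first of these times
  from the others yields return times below \<open>N\<close>.\<close>

lemma return_times_positive_density:
  fixes F :: "complex set"
  assumes "finite F" and F: "F \<subseteq> unit_circle" and "0 < \<eta>"
  shows "\<exists>p>0. \<forall>N. p * real N \<le> real (card {n. n < N \<and> (\<forall>\<mu>\<in>F. cmod (\<mu> ^ n - 1) < \<eta>)})"
proof -
  have "compact unit_circle" by simp
  then obtain C where C: "finite C" "unit_circle \<subseteq> (\<Union>c\<in>C. ball c (\<eta>/2))"
    using \<open>0 < \<eta>\<close> half_gt_zero[of \<eta>] unfolding compact_eq_totally_bounded by blast
  have "\<exists>c\<in>C. dist c (\<mu> ^ n) < \<eta>/2" if "\<mu> \<in> F" for \<mu> n
  proof -
    have "\<mu> ^ n \<in> unit_circle" using F that by (auto simp: norm_power)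
    then have "\<exists>c\<in>C. \<mu> ^ n \<in> ball c (\<eta>/2)" using C(2) by blast
    then show ?thesis by simp
  qed
  then have "\<forall>\<mu> n. \<exists>c. \<mu> \<in> F \<longrightarrow> c \<in> C \<and> dist c (\<mu> ^ n) < \<eta>/2" by blast
  then obtain c where c: "\<And>\<mu> n. \<mu> \<in> F \<Longrightarrow> c \<mu> n \<in> C \<and> dist (c \<mu> n) (\<mu> ^ n) < \<eta>/2"
    by metis
  define cell where "cell n = restrict (\<lambda>\<mu>. c \<mu> n) F" for n
  define P where "P = F \<rightarrow>\<^sub>E C"
  have finP: "finite P" unfolding P_def using assms C(1) by (simp add: finite_PiE)
  have cellP: "cell n \<in> P" for n unfolding cell_def P_def using c by auto
  then have K: "0 < card P" using finP by (auto simp: card_gt_0_iff)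
  have ret: "cmod (\<mu> ^ (n - m) - 1) < \<eta>" if "m \<le> n" "cell m = cell n" "\<mu> \<in> F" for m n \<mu>
  proof -
    have "c \<mu> m = c \<mu> n" using that(2,3) unfolding cell_def by (metis restrict_apply')
    then have "dist (c \<mu> n) (\<mu> ^ n) < \<eta>/2" "dist (c \<mu> n) (\<mu> ^ m) < \<eta>/2"
      using c[OF that(3), of m] c[OF that(3), of n] by simp_all
    then have "dist (\<mu> ^ n) (\<mu> ^ m) < \<eta>" by (rule dist_triangle_half_r)
    moreover have "\<mu> ^ n - \<mu> ^ m = \<mu> ^ m * (\<mu> ^ (n - m) - 1)"
      using that(1) by (simp add: algebra_simps flip: power_add)
    moreover have "cmod (\<mu> ^ m) = 1" using F that(3) by (auto simp: norm_power)
    ultimately show ?thesis by (simp add: dist_norm norm_mult)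
  qed
  have "1 / real (card P) * real N \<le> real (card {n. n < N \<and> (\<forall>\<mu>\<in>F. cmod (\<mu> ^ n - 1) < \<eta>)})"
    (is "_ \<le> real (card ?R)") for N
  proof -
    have le: "card {n. n < N \<and> cell n = q} \<le> card ?R" if "q \<in> P" for q
    proof (cases "{n. n < N \<and> cell n = q} = {}")
      case False
      define m where "m = (LEAST n. n < N \<and> cell n = q)"
      have m: "m < N \<and> cell m = q" unfolding m_def by (rule LeastI_ex) (use False in auto)
      have least: "m \<le> n" if "n < N \<and> cell n = q" for n unfolding m_def using that by (rule Least_le)
      show ?thesis
      proof (rule card_inj_on_le[where f = "\<lambda>n. n - m"])
        show "inj_on (\<lambda>n. n - m) {n. n < N \<and> cell n = q}"
          using least by (auto intro!: inj_onI) (metis eq_diff_iff)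
        show "(\<lambda>n. n - m) ` {n. n < N \<and> cell n = q} \<subseteq> ?R"
          using least m ret by auto
      qed simp
    next
      case True
      then show ?thesis by (simp only: card.empty le0)
    qed
    have "{..<N} = (\<Union>q\<in>P. {n. n < N \<and> cell n = q})" using cellP by auto
    then have "N = card (\<Union>q\<in>P. {n. n < N \<and> cell n = q})" using card_lessThan[of N] by simp
    also have "\<dots> \<le> (\<Sum>q\<in>P. card {n. n < N \<and> cell n = q})" by (rule card_UN_le[OF finP])
    also have "\<dots> \<le> card P * card ?R" using sum_bounded_above[of P _ "card ?R"] le by simp
    finally have "real N \<le> real (card P) * real (card ?R)" by (simp only: flip: of_nat_mult of_nat_le_iff)
    then show ?thesis using K by (simp add: field_simps)
  qed
  then show ?thesis using K by (intro exI[of _ "1 / real (card P)"]) simp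
qed

text \<open>A one-sided maximal inequality. The walk \<open>f n = card (B \<inter> {..<n}) - d n\<close> drifts to minus
  infinity at rate at least \<open>d - d'\<close>. The times \<open>m\<close> wanted are those after which the walk never
  exceeds \<open>f m\<close>. The future maximum \<open>g m = (SUP n\<in>{m..}. f n)\<close> decreases only at such times, by at
  most \<open>d\<close> each, so its overall descent forces them to be frequent.\<close>

lemma sunset_points_frequent:
  fixes B :: "nat set" and d d' :: real
  assumes "0 \<le> d'" "d' < d"
    and B: "\<forall>\<^sub>F N in sequentially. real (card (B \<inter> {..<N})) \<le> d' * real N"
  shows "\<forall>\<^sub>F N in sequentially.
    (d - d') * real N \<le> d * real (card {m. m < N \<and> (\<forall>L. real (card (B \<inter> {m..<m + L})) \<le> d * real L)})"
proof -
  define f where "f n = real (card (B \<inter> {..<n})) - d * real n" for n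
  define good where "good m \<longleftrightarrow> (\<forall>L. real (card (B \<inter> {m..<m + L})) \<le> d * real L)" for m
  obtain N0 where N0: "\<And>n. n \<ge> N0 \<Longrightarrow> real (card (B \<inter> {..<n})) \<le> d' * real n"
    using B by (auto simp: eventually_sequentially)
  have diff: "f (m + L) - f m = real (card (B \<inter> {m..<m + L})) - d * real L" for m L
  proof -
    have split: "B \<inter> {..<m + L} = (B \<inter> {..<m}) \<union> (B \<inter> {m..<m + L})" by auto
    have "card (B \<inter> {..<m + L}) = card (B \<inter> {..<m}) + card (B \<inter> {m..<m + L})"
      unfolding split by (rule card_Un_disjoint) auto
    then show ?thesis unfolding f_def by (simp add: algebra_simps)
  qed
  have good_f: "good m \<longleftrightarrow> (\<forall>L. f (m + L) \<le> f m)" for m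
  proof -
    have "real (card (B \<inter> {m..<m + L})) \<le> d * real L \<longleftrightarrow> f (m + L) \<le> f m" for L
      using diff[of m L] by linarith
    then show ?thesis unfolding good_def by simp
  qed
  have f_le: "f n \<le> - (d - d') * real n" if "n \<ge> N0" for n
    using N0[OF that] unfolding f_def by (simp add: algebra_simps)
  have bdd: "bdd_above (f ` {m..})" for m
  proof (rule bdd_aboveI2[where M = "real N0"])
    fix n
    show "f n \<le> real N0"
    proof (cases "n \<ge> N0")
      case True
      have "0 \<le> (d - d') * real n" using assms by simp
      then show ?thesis using f_le[OF True] by (simp add: algebra_simps)
    next
      case False
      have "card (B \<inter> {..<n}) \<le> n" using card_mono[of "{..<n}" "B \<inter> {..<n}"] by simp
      moreover have "0 \<le> d * real n" using assms by simp
      ultimately show ?thesis using False unfolding f_def by simp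
    qed
  qed
  define g where "g m = (SUP n\<in>{m..}. f n)" for m
  have f_g: "f n \<le> g m" if "m \<le> n" for m n
    unfolding g_def using bdd that by (auto intro: cSUP_upper)
  have drop: "g m \<le> g (Suc m) + (if good m then d else 0)" for m
    unfolding g_def[of m]
  proof (rule cSUP_least)
    fix n assume "n \<in> {m..}"
    then consider "n = m" | "Suc m \<le> n" by fastforce
    then show "f n \<le> g (Suc m) + (if good m then d else 0)"
    proof cases
      case 2
      then show ?thesis using f_g[OF 2] assms by (simp split: if_splits)
    next
      case 1
      show ?thesis
      proof (cases "good m")
        case True
        have "f m - d \<le> f (m + 1)" using diff[of m 1] by simp
        also have "\<dots> \<le> g (Suc m)" by (rule f_g) simp
        finally show ?thesis using True 1 by simp
      next
        case False
        then obtain L where L: "f m < f (m + L)" unfolding good_f by (auto simp: not_le)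
        then have "Suc m \<le> m + L" by (cases L) auto
        then show ?thesis using L f_g[of "Suc m" "m + L"] False 1 by simp
      qed
    qed
  qed simp
  have count: "g 0 \<le> g N + d * real (card {m. m < N \<and> good m})" for N
  proof (induction N)
    case (Suc N)
    have "{m. m < Suc N \<and> good m} = (if good N then insert N {m. m < N \<and> good m} else {m. m < N \<and> good m})"
      by (auto simp: less_Suc_eq)
    then show ?case using Suc drop[of N] by (auto simp: algebra_simps split: if_splits)
  qed simp
  have "(d - d') * real N \<le> d * real (card {m. m < N \<and> good m})" if "N \<ge> N0" for N
  proof -
    have "0 \<le> g 0" using f_g[of 0 0] by (simp add: f_def)
    moreover have "g N \<le> - (d - d') * real N"
      unfolding g_def
    proof (rule cSUP_least)
      fix n assume n: "n \<in> {N..}"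
      have "f n \<le> - (d - d') * real n" using f_le n that by auto
      also have "\<dots> \<le> - (d - d') * real N"
        using n assms by (intro mult_left_mono_neg) auto
      finally show "f n \<le> - (d - d') * real N" .
    qed simp
    ultimately show ?thesis using count[of N] by (simp add: algebra_simps)
  qed
  then show ?thesis unfolding good_def by (rule eventually_sequentiallyI)
qed

section \<open>Exponential sums\<close>

lemma unimodular_power_average:
  fixes c :: complex
  assumes "cmod c = 1"
  shows "(\<lambda>N. (\<Sum>n<N. c ^ n) / of_nat N) \<longlonglongrightarrow> (if c = 1 then 1 else 0)"
proof (cases "c = 1")
  case True
  have "\<forall>\<^sub>F N in sequentially. (\<Sum>n<N. c ^ n) / of_nat N = 1"
    using eventually_gt_at_top[of 0] by eventually_elim (simp add: True)
  then show ?thesis using True by (simp add: tendsto_eventually)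
next
  case False
  have lim: "(\<lambda>N. (2 / cmod (1 - c)) * inverse (real N)) \<longlonglongrightarrow> 0"
    by (rule tendsto_mult_right_zero[OF lim_inverse_n])
  have bound: "cmod ((\<Sum>n<N. c ^ n) / of_nat N) \<le> (2 / cmod (1 - c)) * inverse (real N)" for N
  proof -
    have "cmod (1 - c ^ N) \<le> 2"
      using norm_triangle_ineq4[of 1 "c ^ N"] assms by (simp add: norm_power)
    then have "cmod (\<Sum>n<N. c ^ n) \<le> 2 / cmod (1 - c)"
      using False by (simp add: sum_gp_strict norm_divide divide_right_mono)
    then have "cmod (\<Sum>n<N. c ^ n) * inverse (real N) \<le> 2 / cmod (1 - c) * inverse (real N)"
      by (rule mult_right_mono) simp
    then show ?thesis by (simp only: norm_divide divide_inverse[of "cmod (\<Sum>n<N. c ^ n)"] norm_of_nat)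
  qed
  have "(\<lambda>N. (\<Sum>n<N. c ^ n) / of_nat N) \<longlonglongrightarrow> 0"
    by (rule Lim_null_comparison[OF always_eventually[OF allI[OF bound]] lim])
  then show ?thesis using False by simp
qed

text \<open>Expanding the square leaves the averages of the powers of \<open>\<mu> * cnj \<nu>\<close>, of which only the
  diagonal ones survive in the limit.\<close>

lemma exponential_sum_mean_square:
  assumes "finite S" "S \<subseteq> unit_circle"
  shows "(\<lambda>N. (\<Sum>n<N. (cmod (\<Sum>\<mu>\<in>S. \<mu> ^ n))\<^sup>2) / real N) \<longlonglongrightarrow> real (card S)"
proof -
  have "(\<lambda>N. \<Sum>\<mu>\<in>S. \<Sum>\<nu>\<in>S. (\<Sum>n<N. (\<mu> * cnj \<nu>) ^ n) / of_nat N)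
      \<longlonglongrightarrow> (\<Sum>\<mu>\<in>S. \<Sum>\<nu>\<in>S. if \<mu> * cnj \<nu> = 1 then 1 else 0)"
    using assms(2) by (intro tendsto_sum unimodular_power_average) (auto simp: norm_mult subset_iff)
  moreover have "(\<Sum>\<nu>\<in>S. if \<mu> * cnj \<nu> = 1 then 1 else 0 :: complex) = 1" if "\<mu> \<in> S" for \<mu>
  proof -
    have "\<mu> * cnj \<nu> = 1 \<longleftrightarrow> \<nu> = \<mu>" if "\<nu> \<in> S" for \<nu>
    proof -
      have nu: "cnj \<nu> * \<nu> = 1" using assms that complex_norm_square[of \<nu>] by (auto simp: mult.commute)
      show ?thesis
      proof
        assume "\<mu> * cnj \<nu> = 1"
        then have "\<mu> * (cnj \<nu> * \<nu>) = \<nu>" by (simp flip: mult.assoc)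
        then show "\<nu> = \<mu>" using nu by simp
      qed (use nu in \<open>simp add: mult.commute\<close>)
    qed
    then have "(\<Sum>\<nu>\<in>S. if \<mu> * cnj \<nu> = 1 then 1 else 0 :: complex) = (\<Sum>\<nu>\<in>S. if \<nu> = \<mu> then 1 else 0)"
      by (intro sum.cong) auto
    then show ?thesis using assms(1) that by simp
  qed
  moreover have "(\<Sum>\<mu>\<in>S. \<Sum>\<nu>\<in>S. (\<Sum>n<N. (\<mu> * cnj \<nu>) ^ n) / of_nat N)
     = of_real ((\<Sum>n<N. (cmod (\<Sum>\<mu>\<in>S. \<mu> ^ n))\<^sup>2) / real N)" for N
  proof -
    have "of_real ((cmod (\<Sum>\<mu>\<in>S. \<mu> ^ n))\<^sup>2) = (\<Sum>\<mu>\<in>S. \<Sum>\<nu>\<in>S. (\<mu> * cnj \<nu>) ^ n)" for n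
      by (simp only: complex_norm_square sum_product power_mult_distrib cnj_sum complex_cnj_power)
    then have "of_real (\<Sum>n<N. (cmod (\<Sum>\<mu>\<in>S. \<mu> ^ n))\<^sup>2) = (\<Sum>n<N. \<Sum>\<mu>\<in>S. \<Sum>\<nu>\<in>S. (\<mu> * cnj \<nu>) ^ n)"
      by simp
    also have "\<dots> = (\<Sum>\<mu>\<in>S. \<Sum>n<N. \<Sum>\<nu>\<in>S. (\<mu> * cnj \<nu>) ^ n)" by (rule sum.swap)
    also have "\<dots> = (\<Sum>\<mu>\<in>S. \<Sum>\<nu>\<in>S. \<Sum>n<N. (\<mu> * cnj \<nu>) ^ n)"
      by (intro sum.cong refl sum.swap)
    finally have eq: "of_real (\<Sum>n<N. (cmod (\<Sum>\<mu>\<in>S. \<mu> ^ n))\<^sup>2) = (\<Sum>\<mu>\<in>S. \<Sum>\<nu>\<in>S. \<Sum>n<N. (\<mu> * cnj \<nu>) ^ n)" .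
    show ?thesis unfolding of_real_divide eq by (simp add: sum_divide_distrib)
  qed
  ultimately have "(\<lambda>N. complex_of_real ((\<Sum>n<N. (cmod (\<Sum>\<mu>\<in>S. \<mu> ^ n))\<^sup>2) / real N))
     \<longlonglongrightarrow> of_real (real (card S))"
    by simp
  then show ?thesis by (rule tendsto_of_real_iff[THEN iffD1])
qed

text \<open>Chebyshev's inequality for the mean square; the factor 2 absorbs the passage to the limit.\<close>

lemma exponential_sum_rarely_large:
  assumes "finite S" "S \<subseteq> unit_circle" "S \<noteq> {}" "0 < \<kappa>"
  shows "\<forall>\<^sub>F N in sequentially.
    real (card {n. n < N \<and> \<kappa> * real (card S) \<le> cmod (\<Sum>\<mu>\<in>S. \<mu> ^ n)}) \<le> 2 / (real (card S) * \<kappa>\<^sup>2) * real N"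
proof -
  have M: "0 < card S" using assms by (simp add: card_gt_0_iff)
  have "\<forall>\<^sub>F N in sequentially. (\<Sum>n<N. (cmod (\<Sum>\<mu>\<in>S. \<mu> ^ n))\<^sup>2) / real N < 2 * real (card S)"
    using M by (intro order_tendstoD(2)[OF exponential_sum_mean_square[OF assms(1,2)]]) simp
  then show ?thesis
    using eventually_gt_at_top[of 0]
  proof eventually_elim
    case (elim N)
    define A where "A = {n. n < N \<and> \<kappa> * real (card S) \<le> cmod (\<Sum>\<mu>\<in>S. \<mu> ^ n)}"
    have "real (card A) * (\<kappa> * real (card S))\<^sup>2 = (\<Sum>n\<in>A. (\<kappa> * real (card S))\<^sup>2)" by simp
    also have "\<dots> \<le> (\<Sum>n\<in>A. (cmod (\<Sum>\<mu>\<in>S. \<mu> ^ n))\<^sup>2)"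
      using assms(4) by (intro sum_mono power_mono) (auto simp: A_def)
    also have "\<dots> \<le> (\<Sum>n<N. (cmod (\<Sum>\<mu>\<in>S. \<mu> ^ n))\<^sup>2)"
      by (intro sum_mono2) (auto simp: A_def)
    also have "\<dots> \<le> 2 * real (card S) * real N" using elim by (simp add: field_simps)
    finally have "(real (card A) * (real (card S) * \<kappa>\<^sup>2)) * real (card S) \<le> (2 * real N) * real (card S)"
      by (simp add: power2_eq_square algebra_simps)
    then have "real (card A) * (real (card S) * \<kappa>\<^sup>2) \<le> 2 * real N"
      using M by (subst (asm) mult_le_cancel_right) auto
    then show ?case using M assms(4) unfolding A_def[symmetric] by (simp add: field_simps)
  qed
qed

section \<open>Unimodular eigenvectors\<close>

definition eigenspace :: "('a::complex_vector \<Rightarrow> 'a) \<Rightarrow> complex \<Rightarrow> 'a set" where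
  "eigenspace T z = {x. T x - z *\<^sub>C x = 0}"

definition unimodular_span :: "('a::complex_vector \<Rightarrow> 'a) \<Rightarrow> 'a set" where
  "unimodular_span T = cspan (\<Union>z\<in>unit_circle. eigenspace T z)"

locale bounded_clinear_operator =
  fixes T :: "'a::cbanach \<Rightarrow> 'a"
  assumes bounded_clinear: "bounded_clinear T"
begin

lemma module_hom: "module_hom scaleC scaleC T"
  using bounded_clinear
  unfolding bounded_clinear_def Vector_Spaces.linear_iff module_hom_iff module_iff_vector_space
  by blast

lemma T_scaleC: "T (a *\<^sub>C x) = a *\<^sub>C T x"
  by (rule module_hom.scale[OF module_hom])

lemma bounded_linear: "bounded_linear T"
proof -
  obtain K where "\<And>x. norm (T x) \<le> norm x * K"
    using bounded_clinear unfolding bounded_clinear_def by auto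
  then show ?thesis
    by (intro bounded_linear_intro) (auto simp: scaleR_scaleC T_scaleC module_hom.add[OF module_hom])
qed

lemma bounded_linear_power: "bounded_linear (T ^^ n)"
proof (induction n)
  case 0
  show ?case using bounded_linear_ident by (simp add: id_def)
next
  case (Suc n)
  then show ?case using bounded_linear_compose[OF bounded_linear Suc] by (simp add: comp_def)
qed

sublocale power: bounded_linear "T ^^ n" for n
  by (rule bounded_linear_power)

lemma power_scaleC: "(T ^^ n) (a *\<^sub>C x) = a *\<^sub>C (T ^^ n) x"
  by (induction n) (simp_all add: T_scaleC)

lemma power_eigenvector: "x \<in> eigenspace T z \<Longrightarrow> (T ^^ n) x = z ^ n *\<^sub>C x"
  by (induction n) (simp_all add: T_scaleC eigenspace_def scaleC_one scaleC_scaleC mult.commute)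

lemma unimodular_span_subspace: "complex_vector.subspace (unimodular_span T)"
  unfolding unimodular_span_def by (rule complex_vector.subspace_span)

lemma eigenvector_in_unimodular_span:
  "z \<in> unit_circle \<Longrightarrow> x \<in> eigenspace T z \<Longrightarrow> x \<in> unimodular_span T"
  unfolding unimodular_span_def by (rule complex_vector.span_base) blast

lemma unimodular_span_power:
  assumes "y \<in> unimodular_span T"
  shows "(T ^^ n) y \<in> unimodular_span T"
  using assms unfolding unimodular_span_def
proof (rule complex_vector.span_induct)
  show "complex_vector.subspace {y. (T ^^ n) y \<in> cspan (\<Union>z\<in>unit_circle. eigenspace T z)}"
    by (rule complex_vector.subspaceI)
       (auto simp: power.zero power.add power_scaleC complex_vector.span_zero
         complex_vector.span_add complex_vector.span_scale)
next
  fix x assume x: "x \<in> (\<Union>z\<in>unit_circle. eigenspace T z)"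
  then obtain z where "x \<in> eigenspace T z" by blast
  then show "(T ^^ n) x \<in> cspan (\<Union>z\<in>unit_circle. eigenspace T z)"
    using x by (simp only: power_eigenvector complex_vector.span_base complex_vector.span_scale)
qed

text \<open>The closeness is controlled by finitely many eigenvalues with a bound linear in \<open>\<eta>\<close>. This form
  allows return times to be subtracted from each other, which closeness of the orbit points alone
  does not, as \<open>T\<close> need not be an isometry.\<close>

lemma unimodular_span_almost_periodic:
  assumes "y \<in> unimodular_span T"
  shows "\<exists>F C. finite F \<and> F \<subseteq> unit_circle \<and> 0 \<le> C \<and>
    (\<forall>n \<eta>. 0 \<le> \<eta> \<longrightarrow> (\<forall>\<mu>\<in>F. cmod (\<mu> ^ n - 1) \<le> \<eta>) \<longrightarrow> norm ((T ^^ n) y - y) \<le> C * \<eta>)"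
    (is "?P y")
  using assms unfolding unimodular_span_def
proof (rule complex_vector.span_induct)
  show "complex_vector.subspace {y. ?P y}"
  proof (rule complex_vector.subspaceI)
    show "0 \<in> {y. ?P y}"
      by (intro CollectI exI[of _ "{}"] exI[of _ 0]) (simp add: power.zero)
  next
    fix x y assume "x \<in> {y. ?P y}" "y \<in> {y. ?P y}"
    then obtain F C F' C' where
      F: "finite F" "F \<subseteq> unit_circle" "0 \<le> C"
        "\<And>n \<eta>. 0 \<le> \<eta> \<Longrightarrow> (\<forall>\<mu>\<in>F. cmod (\<mu> ^ n - 1) \<le> \<eta>) \<Longrightarrow> norm ((T ^^ n) x - x) \<le> C * \<eta>" and
      F': "finite F'" "F' \<subseteq> unit_circle" "0 \<le> C'"
        "\<And>n \<eta>. 0 \<le> \<eta> \<Longrightarrow> (\<forall>\<mu>\<in>F'. cmod (\<mu> ^ n - 1) \<le> \<eta>) \<Longrightarrow> norm ((T ^^ n) y - y) \<le> C' * \<eta>"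
      by blast
    have "norm ((T ^^ n) (x + y) - (x + y)) \<le> (C + C') * \<eta>"
      if "0 \<le> \<eta>" "\<forall>\<mu>\<in>F \<union> F'. cmod (\<mu> ^ n - 1) \<le> \<eta>" for n \<eta>
    proof -
      have "norm ((T ^^ n) x - x) \<le> C * \<eta>" "norm ((T ^^ n) y - y) \<le> C' * \<eta>"
        using that F(4) F'(4) by auto
      then show ?thesis
        using norm_triangle_ineq[of "(T ^^ n) x - x" "(T ^^ n) y - y"]
        by (simp add: power.add algebra_simps)
    qed
    then show "x + y \<in> {y. ?P y}"
      using F(1-3) F'(1-3) by (auto intro!: exI[of _ "F \<union> F'"] exI[of _ "C + C'"])
  next
    fix c x assume "x \<in> {y. ?P y}"
    then obtain F C where
      F: "finite F" "F \<subseteq> unit_circle" "0 \<le> C"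
        "\<And>n \<eta>. 0 \<le> \<eta> \<Longrightarrow> (\<forall>\<mu>\<in>F. cmod (\<mu> ^ n - 1) \<le> \<eta>) \<Longrightarrow> norm ((T ^^ n) x - x) \<le> C * \<eta>"
      by blast
    have "norm ((T ^^ n) (c *\<^sub>C x) - c *\<^sub>C x) \<le> cmod c * C * \<eta>"
      if "0 \<le> \<eta>" "\<forall>\<mu>\<in>F. cmod (\<mu> ^ n - 1) \<le> \<eta>" for n \<eta>
    proof -
      have "norm ((T ^^ n) (c *\<^sub>C x) - c *\<^sub>C x) = cmod c * norm ((T ^^ n) x - x)"
        by (simp add: power_scaleC norm_scaleC flip: complex_vector.scale_right_diff_distrib)
      also have "\<dots> \<le> cmod c * (C * \<eta>)" using F(4)[OF that] by (rule mult_left_mono) simp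
      finally show ?thesis by simp
    qed
    then show "c *\<^sub>C x \<in> {y. ?P y}"
      using F(1-3) by (auto intro!: exI[of _ F] exI[of _ "cmod c * C"])
  qed
next
  fix x assume "x \<in> (\<Union>z\<in>unit_circle. eigenspace T z)"
  then obtain z where z: "z \<in> unit_circle" "x \<in> eigenspace T z" by blast
  have "norm ((T ^^ n) x - x) = cmod (z ^ n - 1) * norm x" for n
  proof -
    have "(T ^^ n) x - x = (z ^ n - 1) *\<^sub>C x"
      using z(2) by (simp add: power_eigenvector complex_vector.scale_left_diff_distrib scaleC_one)
    then show ?thesis by (simp add: norm_scaleC)
  qed
  then have "norm ((T ^^ n) x - x) \<le> norm x * \<eta>" if "\<forall>\<mu>\<in>{z}. cmod (\<mu> ^ n - 1) \<le> \<eta>" for n \<eta>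
    using that mult_right_mono[of "cmod (z ^ n - 1)" \<eta> "norm x"] by (simp add: mult.commute)
  then show "?P x"
    using z(1) by (intro exI[of _ "{z}"] exI[of _ "norm x"]) auto
qed

section \<open>Vectors with rarely large orbits\<close>

definition rarely_large :: "real \<Rightarrow> real \<Rightarrow> 'a \<Rightarrow> bool" where
  "rarely_large e d y \<longleftrightarrow>
     (\<forall>\<^sub>F N in sequentially. real (card {n. n < N \<and> e \<le> norm ((T ^^ n) y)}) \<le> d * real N)"

lemma rarely_large_mono:
  assumes "rarely_large e d y" and "e \<le> e'"
  shows "rarely_large e' d y"
  using assms(1) unfolding rarely_large_def
proof eventually_elim
  case (elim N)
  have "card {n. n < N \<and> e' \<le> norm ((T ^^ n) y)} \<le> card {n. n < N \<and> e \<le> norm ((T ^^ n) y)}"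
    using assms(2) by (intro card_mono) auto
  then show ?case using elim by linarith
qed

lemma rarely_large_add:
  assumes "rarely_large e d x" "rarely_large e' d' y"
  shows "rarely_large (e + e') (d + d') (x + y)"
  using assms unfolding rarely_large_def
proof eventually_elim
  case (elim N)
  have "{n. n < N \<and> e + e' \<le> norm ((T ^^ n) (x + y))} \<subseteq>
      {n. n < N \<and> e \<le> norm ((T ^^ n) x)} \<union> {n. n < N \<and> e' \<le> norm ((T ^^ n) y)}"
  proof
    fix n assume n: "n \<in> {n. n < N \<and> e + e' \<le> norm ((T ^^ n) (x + y))}"
    then have "e + e' \<le> norm ((T ^^ n) x) + norm ((T ^^ n) y)"
      using norm_triangle_ineq[of "(T ^^ n) x" "(T ^^ n) y"] by (simp add: power.add)
    then have "e \<le> norm ((T ^^ n) x) \<or> e' \<le> norm ((T ^^ n) y)" by linarith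
    then show "n \<in> {n. n < N \<and> e \<le> norm ((T ^^ n) x)} \<union> {n. n < N \<and> e' \<le> norm ((T ^^ n) y)}"
      using n by blast
  qed
  then have "card {n. n < N \<and> e + e' \<le> norm ((T ^^ n) (x + y))} \<le>
      card ({n. n < N \<and> e \<le> norm ((T ^^ n) x)} \<union> {n. n < N \<and> e' \<le> norm ((T ^^ n) y)})"
    by (rule card_mono[rotated]) simp
  also have "\<dots> \<le> card {n. n < N \<and> e \<le> norm ((T ^^ n) x)} + card {n. n < N \<and> e' \<le> norm ((T ^^ n) y)}"
    by (rule card_Un_le)
  finally show ?case using elim by (simp add: algebra_simps)
qed

text \<open>The size of \<open>v\<close> does not enter: the orbit of \<open>y\<close> starts near \<open>v\<close>, however large \<open>v\<close> is, and
  is nevertheless small at most times. Such vectors \<open>v\<close> are the raw material for the perturbations,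
  which have to move the orbit to a distant target without disturbing what was achieved before.\<close>

definition rarely_large_limits :: "'a set" where
  "rarely_large_limits = {v. \<forall>e>0. \<forall>d>0. \<exists>y\<in>unimodular_span T. norm (y - v) < e \<and> rarely_large e d y}"

lemma subspace_rarely_large_limits: "complex_vector.subspace rarely_large_limits"
proof (rule complex_vector.subspaceI)
  have "rarely_large e d 0" if "0 < e" "0 < d" for e d :: real
    using that unfolding rarely_large_def by (simp add: power.zero)
  then show "0 \<in> rarely_large_limits"
    unfolding rarely_large_limits_def
    by (intro CollectI allI impI bexI[of _ 0])
       (simp_all add: complex_vector.subspace_0[OF unimodular_span_subspace])
next
  fix v v' assume v: "v \<in> rarely_large_limits" "v' \<in> rarely_large_limits"
  show "v + v' \<in> rarely_large_limits"
    unfolding rarely_large_limits_def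
  proof (intro CollectI allI impI)
    fix e d :: real assume "0 < e" "0 < d"
    then have "0 < e/2" "0 < d/2" by auto
    then obtain y y' where y: "y \<in> unimodular_span T" "norm (y - v) < e/2" "rarely_large (e/2) (d/2) y"
      and y': "y' \<in> unimodular_span T" "norm (y' - v') < e/2" "rarely_large (e/2) (d/2) y'"
      using v unfolding rarely_large_limits_def by blast
    have "norm (y + y' - (v + v')) < e"
      using y(2) y'(2) norm_triangle_ineq[of "y - v" "y' - v'"] by (simp add: algebra_simps)
    moreover have "y + y' \<in> unimodular_span T"
      using complex_vector.subspace_add[OF unimodular_span_subspace] y(1) y'(1) by blast
    ultimately show "\<exists>y\<in>unimodular_span T. norm (y - (v + v')) < e \<and> rarely_large e d y"
      using rarely_large_add[OF y(3) y'(3)] by auto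
  qed
next
  fix c v assume v: "v \<in> rarely_large_limits"
  show "c *\<^sub>C v \<in> rarely_large_limits"
    unfolding rarely_large_limits_def
  proof (intro CollectI allI impI)
    fix e d :: real assume "0 < e" "0 < d"
    define e' where "e' = e / (cmod c + 1)"
    have e': "0 < e'" "cmod c * e' < e"
      using \<open>0 < e\<close> by (simp_all add: e'_def field_simps add_pos_nonneg)
    obtain y where y: "y \<in> unimodular_span T" "norm (y - v) < e'" "rarely_large e' d y"
      using v e'(1) \<open>0 < d\<close> unfolding rarely_large_limits_def by blast
    have "norm (c *\<^sub>C y - c *\<^sub>C v) = cmod c * norm (y - v)"
      by (simp add: norm_scaleC flip: complex_vector.scale_right_diff_distrib)
    also have "\<dots> \<le> cmod c * e'" using y(2) by (intro mult_left_mono) auto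
    finally have "norm (c *\<^sub>C y - c *\<^sub>C v) < e" using e' by simp
    moreover have "rarely_large e d (c *\<^sub>C y)"
      using y(3) unfolding rarely_large_def
    proof eventually_elim
      case (elim N)
      have "e' \<le> norm ((T ^^ n) y)" if "e \<le> norm ((T ^^ n) (c *\<^sub>C y))" for n
      proof (rule ccontr)
        assume "\<not> e' \<le> norm ((T ^^ n) y)"
        then have "cmod c * norm ((T ^^ n) y) \<le> cmod c * e'" by (intro mult_left_mono) auto
        then show False using that e' by (simp add: power_scaleC norm_scaleC)
      qed
      then have "card {n. n < N \<and> e \<le> norm ((T ^^ n) (c *\<^sub>C y))} \<le> card {n. n < N \<and> e' \<le> norm ((T ^^ n) y)}"
        by (intro card_mono) auto
      then show ?case using elim by linarith
    qed
    moreover have "c *\<^sub>C y \<in> unimodular_span T"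
      using complex_vector.subspace_scale[OF unimodular_span_subspace] y(1) by blast
    ultimately show "\<exists>y\<in>unimodular_span T. norm (y - c *\<^sub>C v) < e \<and> rarely_large e d y" by blast
  qed
qed

lemma closed_rarely_large_limits: "closed rarely_large_limits"
proof -
  have "v \<in> rarely_large_limits" if v: "v \<in> closure rarely_large_limits" for v
    unfolding rarely_large_limits_def
  proof (intro CollectI allI impI)
    fix e d :: real assume "0 < e" "0 < d"
    then obtain v' where v': "v' \<in> rarely_large_limits" "dist v' v < e/2"
      using v half_gt_zero unfolding closure_approachable by blast
    then obtain y where y: "y \<in> unimodular_span T" "norm (y - v') < e/2" "rarely_large (e/2) d y"
      using \<open>0 < e\<close> \<open>0 < d\<close> half_gt_zero unfolding rarely_large_limits_def by blast
    have "norm (y - v) < e"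
      using y(2) v'(2) norm_triangle_ineq[of "y - v'" "v' - v"] by (simp add: dist_norm)
    then show "\<exists>y\<in>unimodular_span T. norm (y - v) < e \<and> rarely_large e d y"
      using y rarely_large_mono[OF y(3), of e] \<open>0 < e\<close> by auto
  qed
  then show ?thesis by (meson closure_subset closure_subset_eq subsetI)
qed

text \<open>The average of \<open>M\<close> eigenvectors near \<open>u\<close> with distinct eigenvalues starts near \<open>u\<close>; along the
  orbit the phases decorrelate and the average mostly cancels.\<close>

lemma accumulated_eigenvector_rarely_large_limit:
  assumes accum: "\<And>e. 0 < e \<Longrightarrow> infinite {\<mu> \<in> unit_circle. eigenspace T \<mu> \<inter> ball u e \<noteq> {}}"
  shows "u \<in> rarely_large_limits"
  unfolding rarely_large_limits_def
proof (intro CollectI allI impI)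
  fix e d :: real assume "0 < e" "0 < d"
  define \<kappa> where "\<kappa> = e / (2 * (norm u + 1))"
  have \<kappa>: "0 < \<kappa>" using \<open>0 < e\<close> by (simp add: \<kappa>_def add_nonneg_pos)
  \<comment> \<open>An orbit point of norm at least \<open>e\<close> forces the averaged phase to be at least \<open>\<kappa>\<close>, since half
    of \<open>e\<close> is reserved for the distance of the eigenvectors from \<open>u\<close>; \<open>M\<close> makes this rare.\<close>
  define M where "M = Suc (nat \<lceil>2 / (d * \<kappa>\<^sup>2)\<rceil>)"
  have M: "2 / (real M * \<kappa>\<^sup>2) \<le> d" "0 < M"
  proof -
    show "0 < M" by (simp add: M_def)
    have "2 / (d * \<kappa>\<^sup>2) \<le> real M" unfolding M_def by linarith
    then show "2 / (real M * \<kappa>\<^sup>2) \<le> d" using \<kappa> \<open>0 < d\<close> \<open>0 < M\<close> by (simp add: field_simps)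
  qed
  obtain S where S: "S \<subseteq> {\<mu> \<in> unit_circle. eigenspace T \<mu> \<inter> ball u (e/2) \<noteq> {}}" "finite S" "card S = M"
    using infinite_arbitrarily_large[OF accum[OF half_gt_zero[OF \<open>0 < e\<close>]], of M] by blast
  then have S': "S \<subseteq> unit_circle" "S \<noteq> {}" using M(2) by auto
  obtain f where f: "\<And>\<mu>. \<mu> \<in> S \<Longrightarrow> f \<mu> \<in> eigenspace T \<mu> \<and> norm (f \<mu> - u) < e/2"
  proof -
    have "\<forall>\<mu>\<in>S. \<exists>x. x \<in> eigenspace T \<mu> \<and> norm (x - u) < e/2"
      using S(1) by (auto simp: dist_norm norm_minus_commute)
    then show ?thesis using that by metis
  qed
  define y where "y = (1 / of_nat M) *\<^sub>C (\<Sum>\<mu>\<in>S. f \<mu>)"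
  have orbit: "norm ((T ^^ n) y - ((\<Sum>\<mu>\<in>S. \<mu> ^ n) / of_nat M) *\<^sub>C u) < e/2" for n
  proof -
    have "(T ^^ n) y = (1 / of_nat M) *\<^sub>C (\<Sum>\<mu>\<in>S. \<mu> ^ n *\<^sub>C f \<mu>)"
      using f unfolding y_def power_scaleC power.sum
      by (intro arg_cong[where f = "scaleC _"] sum.cong) (auto simp: power_eigenvector)
    moreover have "((\<Sum>\<mu>\<in>S. \<mu> ^ n) / of_nat M) *\<^sub>C u = (1 / of_nat M) *\<^sub>C (\<Sum>\<mu>\<in>S. \<mu> ^ n *\<^sub>C u)"
      by (simp add: scaleC_scaleC flip: complex_vector.scale_sum_left)
    ultimately have "(T ^^ n) y - ((\<Sum>\<mu>\<in>S. \<mu> ^ n) / of_nat M) *\<^sub>C u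
        = (1 / of_nat M) *\<^sub>C (\<Sum>\<mu>\<in>S. \<mu> ^ n *\<^sub>C (f \<mu> - u))"
      by (simp add: complex_vector.scale_right_diff_distrib sum_subtractf)
    moreover have "norm (\<Sum>\<mu>\<in>S. \<mu> ^ n *\<^sub>C (f \<mu> - u)) < (\<Sum>\<mu>\<in>S. e/2)"
    proof (rule le_less_trans[OF norm_sum sum_strict_mono])
      fix \<mu> assume "\<mu> \<in> S"
      moreover from this have "cmod (\<mu> ^ n) = 1" using S'(1) by (auto simp: norm_power)
      ultimately show "norm (\<mu> ^ n *\<^sub>C (f \<mu> - u)) < e/2" using f by (simp add: norm_scaleC)
    qed (use S(2) S'(2) in auto)
    ultimately show ?thesis using S(3) M(2) by (simp add: norm_scaleC norm_divide field_simps)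
  qed
  have "norm (y - u) < e"
    using orbit[of 0] S(3) M(2) \<open>0 < e\<close> by (simp add: scaleC_one)
  moreover have "y \<in> unimodular_span T"
    unfolding y_def using f S'(1)
    by (intro complex_vector.subspace_scale[OF unimodular_span_subspace]
        complex_vector.subspace_sum[OF unimodular_span_subspace])
       (blast intro: eigenvector_in_unimodular_span)
  moreover have "rarely_large e d y"
    using exponential_sum_rarely_large[OF S(2) S' \<kappa>] unfolding rarely_large_def
  proof eventually_elim
    case (elim N)
    have "\<kappa> * real (card S) \<le> cmod (\<Sum>\<mu>\<in>S. \<mu> ^ n)" if n: "e \<le> norm ((T ^^ n) y)" for n
    proof -
      let ?p = "(\<Sum>\<mu>\<in>S. \<mu> ^ n) / of_nat M"
      have "e / 2 < norm (?p *\<^sub>C u)"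
        using orbit[of n] n norm_triangle_ineq[of "(T ^^ n) y - ?p *\<^sub>C u" "?p *\<^sub>C u"] by simp
      also have "\<dots> \<le> cmod ?p * (norm u + 1)" by (simp add: norm_scaleC mult_left_mono)
      finally have "e \<le> cmod ?p * (2 * (norm u + 1))" by (simp add: algebra_simps)
      moreover have "0 < 2 * (norm u + 1)" by (simp add: add_nonneg_pos)
      ultimately have "\<kappa> \<le> cmod ?p" unfolding \<kappa>_def by (simp only: pos_divide_le_eq)
      then show ?thesis using S(3) M(2) by (simp add: norm_divide field_simps)
    qed
    then have "card {n. n < N \<and> e \<le> norm ((T ^^ n) y)}
        \<le> card {n. n < N \<and> \<kappa> * real (card S) \<le> cmod (\<Sum>\<mu>\<in>S. \<mu> ^ n)}"
      by (intro card_mono) auto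
    also have "real \<dots> \<le> 2 / (real M * \<kappa>\<^sup>2) * real N" using elim S(3) by simp
    also have "\<dots> \<le> d * real N" using M(1) by (rule mult_right_mono) simp
    finally show ?case by simp
  qed
  ultimately show "\<exists>y\<in>unimodular_span T. norm (y - u) < e \<and> rarely_large e d y" by blast
qed

section \<open>One step of the construction\<close>

text \<open>The step of the construction. The orbit of \<open>y\<close> is rarely large in every initial segment; for
  \<open>N = 1\<close> and \<open>e < 1\<close> this says that \<open>y\<close> itself is small. The hits come from return times: \<open>y\<close> is
  an orbit point \<open>T\<^sup>m y\<^sub>0\<close> of an approximation \<open>y\<^sub>0\<close> of \<open>w - z\<close>, so its orbit passes near \<open>w - z\<close>
  again and again, at times when the orbit of \<open>z\<close> is back near \<open>z\<close>.\<close>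

lemma exists_perturbation:
  assumes all: "rarely_large_limits = UNIV"
    and z: "z \<in> unimodular_span T" and "0 < r" "0 < e"
  shows "\<exists>y\<in>unimodular_span T. \<exists>p>0.
    (\<forall>N. real (card {n. n < N \<and> e \<le> norm ((T ^^ n) y)}) \<le> e * real N) \<and>
    (\<forall>\<^sub>F N in sequentially. p * real N \<le> real (card {n. n < N \<and> norm ((T ^^ n) (z + y) - w) < r}))"
proof -
  obtain F C where F: "finite F" "F \<subseteq> unit_circle" "0 \<le> C"
    and FC: "\<And>n \<eta>. 0 \<le> \<eta> \<Longrightarrow> (\<forall>\<mu>\<in>F. cmod (\<mu> ^ n - 1) \<le> \<eta>) \<Longrightarrow> norm ((T ^^ n) z - z) \<le> C * \<eta>"
    using unimodular_span_almost_periodic[OF z] by blast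
  define \<eta> where "\<eta> = r / (8 * (C + 1))"
  have \<eta>: "0 < \<eta>" using \<open>0 < r\<close> F(3) by (simp add: \<eta>_def)
  have C\<eta>: "C * (2 * \<eta>) \<le> r / 4" using \<open>0 < r\<close> F(3) by (simp add: \<eta>_def field_simps)
  obtain p where p: "0 < p" "\<And>N. p * real N \<le> real (card {n. n < N \<and> (\<forall>\<mu>\<in>F. cmod (\<mu> ^ n - 1) < \<eta>)})"
    using return_times_positive_density[OF F(1,2) \<eta>] by blast
  have "p \<le> 1"
  proof -
    have "card {n. n < Suc 0 \<and> (\<forall>\<mu>\<in>F. cmod (\<mu> ^ n - 1) < \<eta>)} \<le> card {..<Suc 0}"
      by (rule card_mono) auto
    then show ?thesis using p(2)[of 1] by simp
  qed
  obtain y0 where y0: "y0 \<in> unimodular_span T" "norm (y0 - (w - z)) < min e (r/4)"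
    and rare: "rarely_large (min e (r/4)) (e * p / 2) y0"
  proof -
    have "0 < min e (r/4)" "0 < e * p / 2" using assms p by auto
    then show ?thesis using all that unfolding rarely_large_limits_def by blast
  qed
  define B where "B = {n. e \<le> norm ((T ^^ n) y0)}"
  define good where "good m \<longleftrightarrow> (\<forall>L. real (card (B \<inter> {m..<m + L})) \<le> e * real L)" for m
  have "\<forall>\<^sub>F N in sequentially. real (card (B \<inter> {..<N})) \<le> e * p / 2 * real N"
  proof -
    have "B \<inter> {..<N} = {n. n < N \<and> e \<le> norm ((T ^^ n) y0)}" for N unfolding B_def by auto
    then show ?thesis using rarely_large_mono[OF rare, of e] unfolding rarely_large_def by simp
  qed
  moreover have "0 \<le> e * p / 2" "e * p / 2 < e" using p \<open>p \<le> 1\<close> \<open>0 < e\<close> by auto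
  ultimately have "\<forall>\<^sub>F N in sequentially.
      (e - e * p / 2) * real N \<le> e * real (card {m. m < N \<and> good m})"
    unfolding good_def using sunset_points_frequent by blast
  from eventually_happens'[OF sequentially_bot eventually_conj[OF eventually_gt_at_top[of 0] this]]
  obtain N where N: "0 < N" "(e - e * p / 2) * real N \<le> e * real (card {m. m < N \<and> good m})"
    by blast
  \<comment> \<open>Good starting times have density at least \<open>1 - p / 2\<close> and return times of \<open>z\<close> at least \<open>p\<close>,
    so some time is both.\<close>
  obtain m where m: "good m" "\<forall>\<mu>\<in>F. cmod (\<mu> ^ m - 1) < \<eta>"
  proof (rule ccontr)
    let ?G = "{m. m < N \<and> good m}" and ?R = "{m. m < N \<and> (\<forall>\<mu>\<in>F. cmod (\<mu> ^ m - 1) < \<eta>)}"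
    assume "\<not> thesis"
    then have "?G \<inter> ?R = {}" using that by blast
    then have "card ?G + card ?R = card (?G \<union> ?R)" by (intro card_Un_disjoint[symmetric]) auto
    also have "\<dots> \<le> card {..<N}" by (rule card_mono) auto
    finally have le: "real (card ?G) + real (card ?R) \<le> real N" by simp
    have "e * ((1 - p / 2) * real N) \<le> e * real (card ?G)" using N(2) by (simp add: algebra_simps)
    then have "(1 - p / 2) * real N \<le> real (card ?G)" using \<open>0 < e\<close> by simp
    then have "p / 2 * real N \<le> 0" using le p(2)[of N] by (simp add: algebra_simps)
    then show False using p(1) N(1) by (simp add: mult_le_0_iff)
  qed
  define y where "y = (T ^^ m) y0"
  have y_orbit: "(T ^^ n) y = (T ^^ (m + n)) y0" for n
    unfolding y_def by (simp add: funpow_add add.commute[of m])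
  have yU: "y \<in> unimodular_span T" unfolding y_def by (rule unimodular_span_power[OF y0(1)])
  have small: "real (card {n. n < N \<and> e \<le> norm ((T ^^ n) y)}) \<le> e * real N" for N
  proof -
    have "card {n. n < N \<and> e \<le> norm ((T ^^ n) y)} = card ((\<lambda>n. m + n) ` {n. n < N \<and> e \<le> norm ((T ^^ n) y)})"
      by (rule card_image[symmetric]) simp
    also have "\<dots> \<le> card (B \<inter> {m..<m + N})"
      by (rule card_mono) (auto simp: B_def y_orbit)
    finally show ?thesis using m(1) unfolding good_def by (meson of_nat_mono order_trans)
  qed
  obtain F' C' where F': "finite F'" "F' \<subseteq> unit_circle" "0 \<le> C'"
    and FC': "\<And>n \<eta>. 0 \<le> \<eta> \<Longrightarrow> (\<forall>\<mu>\<in>F'. cmod (\<mu> ^ n - 1) \<le> \<eta>) \<Longrightarrow> norm ((T ^^ n) y0 - y0) \<le> C' * \<eta>"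
    using unimodular_span_almost_periodic[OF y0(1)] by blast
  define \<eta>' where "\<eta>' = min \<eta> (r / (4 * (C' + 1)))"
  have \<eta>': "0 < \<eta>'" "\<eta>' \<le> \<eta>" using \<open>0 < r\<close> F'(3) \<eta> by (simp_all add: \<eta>'_def)
  have C\<eta>': "C' * \<eta>' \<le> r / 4"
  proof -
    have "C' * \<eta>' \<le> C' * (r / (4 * (C' + 1)))"
      using F'(3) by (intro mult_left_mono) (simp_all add: \<eta>'_def)
    also have "\<dots> \<le> r / 4" using \<open>0 < r\<close> F'(3) by (simp add: field_simps)
    finally show ?thesis .
  qed
  define ret where "ret k \<longleftrightarrow> (\<forall>\<mu>\<in>F \<union> F'. cmod (\<mu> ^ k - 1) < \<eta>')" for k
  obtain q where q: "0 < q" "\<And>N. q * real N \<le> real (card {k. k < N \<and> ret k})"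
    using return_times_positive_density[of "F \<union> F'" \<eta>'] F F' \<eta>' unfolding ret_def by auto
  have hit: "norm ((T ^^ (k - m)) (z + y) - w) < r" if k: "ret k" "m \<le> k" for k
  proof -
    \<comment> \<open>A difference of two return times of \<open>z\<close> is again one, up to doubling the error.\<close>
    have "cmod (\<mu> ^ (k - m) - 1) \<le> 2 * \<eta>" if "\<mu> \<in> F" for \<mu>
    proof -
      have "\<mu> ^ m * (\<mu> ^ (k - m) - 1) = (\<mu> ^ k - 1) - (\<mu> ^ m - 1)"
        using k(2) by (simp add: algebra_simps flip: power_add)
      moreover have "cmod (\<mu> ^ m) = 1" using F(2) that by (auto simp: norm_power)
      ultimately have "cmod (\<mu> ^ (k - m) - 1) = cmod ((\<mu> ^ k - 1) - (\<mu> ^ m - 1))"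
        by (metis norm_mult mult_1)
      also have "\<dots> \<le> cmod (\<mu> ^ k - 1) + cmod (\<mu> ^ m - 1)" by (rule norm_triangle_ineq4)
      also have "\<dots> \<le> 2 * \<eta>"
        using k(1) m(2) \<eta>'(2) that unfolding ret_def by (smt (verit) UnI1)
      finally show ?thesis .
    qed
    then have 1: "norm ((T ^^ (k - m)) z - z) \<le> r / 4"
      using FC[of "2 * \<eta>"] \<eta> C\<eta> by force
    have 2: "norm ((T ^^ k) y0 - y0) \<le> r / 4"
      using FC'[of \<eta>' k] k(1) \<eta>' C\<eta>' unfolding ret_def by force
    have "(T ^^ (k - m)) y = (T ^^ k) y0" using y_orbit[of "k - m"] k(2) by simp
    then have "(T ^^ (k - m)) (z + y) - w
        = ((T ^^ (k - m)) z - z) + (((T ^^ k) y0 - y0) + (y0 - (w - z)))"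
      by (simp add: power.add)
    also have "norm \<dots> \<le> norm ((T ^^ (k - m)) z - z) + (norm ((T ^^ k) y0 - y0) + norm (y0 - (w - z)))"
      by (intro norm_triangle_mono order_refl norm_triangle_ineq)
    also have "\<dots> < r" using 1 2 y0(2) \<open>0 < r\<close> by simp
    finally show ?thesis .
  qed
  have "q / 2 * real N \<le> real (card {n. n < N \<and> norm ((T ^^ n) (z + y) - w) < r})"
    if N: "N \<ge> nat \<lceil>2 * real m / q\<rceil>" for N
  proof -
    let ?H = "{n. n < N \<and> norm ((T ^^ n) (z + y) - w) < r}"
    have "{k. k < N \<and> ret k} \<subseteq> {..<m} \<union> (\<lambda>n. m + n) ` ?H"
    proof
      fix k assume k: "k \<in> {k. k < N \<and> ret k}"
      show "k \<in> {..<m} \<union> (\<lambda>n. m + n) ` ?H"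
      proof (cases "m \<le> k")
        case True
        then have "k = m + (k - m)" "k - m \<in> ?H" using k hit by auto
        then show ?thesis by blast
      qed auto
    qed
    then have "card {k. k < N \<and> ret k} \<le> card ({..<m} \<union> (\<lambda>n. m + n) ` ?H)"
      by (rule card_mono[rotated]) simp
    also have "\<dots> \<le> m + card ((\<lambda>n. m + n) ` ?H)" using card_Un_le[of "{..<m}"] by simp
    also have "\<dots> = m + card ?H" by (simp add: card_image)
    finally have "q * real N \<le> real m + real (card ?H)" using q(2)[of N] by linarith
    moreover have "2 * real m / q \<le> real N" using N by linarith
    then have "2 * real m \<le> q * real N" using q(1) by (simp add: field_simps)
    ultimately show ?thesis by simp
  qed
  then have "\<forall>\<^sub>F N in sequentially.
      q / 2 * real N \<le> real (card {n. n < N \<and> norm ((T ^^ n) (z + y) - w) < r})"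
    by (rule eventually_sequentiallyI)
  then show ?thesis using yU small q(1) by (intro bexI[of _ y] exI[of _ "q / 2"]) auto
qed

end

section \<open>Perfectly spanning eigenvectors\<close>

text \<open>An eigenvector that is not a limit of eigenvectors with infinitely many different eigenvalues lies
  in a ball of a fixed countable base in which only finitely many eigenvalues are represented. All
  these finite sets of eigenvalues together form the countable set \<open>D\<close>.\<close>

lemma countable_few_nearby_eigenvalues:
  fixes T :: "'a::complex_normed_vector \<Rightarrow> 'a"
  assumes "separable_space (euclidean :: 'a topology)"
  obtains D where "countable D"
    "\<And>z u e. z \<in> unit_circle - D \<Longrightarrow> u \<in> eigenspace T z \<Longrightarrow> 0 < e \<Longrightarrow>
      infinite {\<mu> \<in> unit_circle. eigenspace T \<mu> \<inter> ball u e \<noteq> {}}"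
proof -
  obtain Q :: "'a set" where Q: "countable Q" "closure Q = UNIV"
    using assms unfolding separable_space_def by auto
  define V where "V q n = {\<mu> \<in> unit_circle. eigenspace T \<mu> \<inter> ball q (inverse (real (Suc n))) \<noteq> {}}" for q n
  define D where "D = (\<Union>q\<in>Q. \<Union>n. if finite (V q n) then V q n else {})"
  show ?thesis
  proof (rule that)
    show "countable D" unfolding D_def by (intro countable_UN Q(1) countableI_type) (simp add: countable_finite)
  next
    fix z u and e :: real assume z: "z \<in> unit_circle - D" and u: "u \<in> eigenspace T z" and "0 < e"
    obtain n where n: "inverse (real (Suc n)) < e/2" using reals_Archimedean half_gt_zero[OF \<open>0 < e\<close>] by blast
    have "u \<in> closure Q" using Q(2) by simp
    then obtain q where q: "q \<in> Q" "dist q u < inverse (real (Suc n))"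
      unfolding closure_approachable by (metis inverse_positive_iff_positive of_nat_0_less_iff zero_less_Suc)
    then have "z \<in> V q n" unfolding V_def using z u by auto
    have "infinite (V q n)"
    proof
      assume "finite (V q n)"
      then have "z \<in> D"
        unfolding D_def using q(1) \<open>z \<in> V q n\<close> by (intro UN_I[of q] UN_I[of n]) simp_all
      then show False using z by blast
    qed
    moreover have "ball q (inverse (real (Suc n))) \<subseteq> ball u e"
    proof
      fix x assume "x \<in> ball q (inverse (real (Suc n)))"
      then have "dist u x < e"
        using dist_triangle[of u x q] q(2) n by (simp add: dist_commute)
      then show "x \<in> ball u e" by simp
    qed
    then have "V q n \<subseteq> {\<mu> \<in> unit_circle. eigenspace T \<mu> \<inter> ball u e \<noteq> {}}"
      unfolding V_def by blast
    ultimately show "infinite {\<mu> \<in> unit_circle. eigenspace T \<mu> \<inter> ball u e \<noteq> {}}"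
      using finite_subset by blast
  qed
qed

lemma perfectly_spanning_off_countable:
  assumes "perfectly_spanning_unimodular T" "countable D"
  shows "closure (cspan (\<Union>z\<in>unit_circle - D. eigenspace T z)) = UNIV"
proof -
  obtain \<sigma> where \<sigma>: "continuous_prob_on_circle \<sigma>"
    and span: "\<And>A. A \<in> sets (completion \<sigma>) \<Longrightarrow> emeasure (completion \<sigma>) A = 1 \<Longrightarrow>
      closure (cspan (\<Union>z\<in>A. {x. T x - z *\<^sub>C x = 0})) = UNIV"
    using assms(1) unfolding perfectly_spanning_unimodular_def by blast
  have sets: "sets \<sigma> = sets (restrict_space borel unit_circle)" and "prob_space \<sigma>"
    and atom: "\<And>z. z \<in> unit_circle \<Longrightarrow> emeasure \<sigma> {z} = 0"
    using \<sigma> unfolding continuous_prob_on_circle_def by auto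
  interpret prob_space \<sigma> by fact
  have space: "space \<sigma> = unit_circle"
    using sets_eq_imp_space_eq[OF sets] by (simp add: space_restrict_space)
  have "{z} \<in> null_sets \<sigma>" if "z \<in> D \<inter> unit_circle" for z
    using that atom[of z] by (intro null_setsI) (auto simp: sets sets_restrict_space image_iff intro!: bexI[of _ "{z}"])
  then have "(\<Union>z\<in>D \<inter> unit_circle. {z}) \<in> null_sets \<sigma>"
    using assms(2) by (intro null_sets_UN') auto
  then have null: "D \<inter> unit_circle \<in> null_sets \<sigma>" by simp
  have diff: "unit_circle - D = space \<sigma> - (D \<inter> unit_circle)" using space by auto
  have A: "unit_circle - D \<in> sets \<sigma>" unfolding diff using null by auto
  have "emeasure \<sigma> (unit_circle - D) = 1"
    unfolding diff using emeasure_Diff_null_set[OF null sets.top] by (simp add: emeasure_space_1)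
  then have "emeasure (completion \<sigma>) (unit_circle - D) = 1"
    using A by (simp add: emeasure_completion)
  then show ?thesis
    using span[of "unit_circle - D"] A by (simp add: eigenspace_def sets_completionI_sets)
qed

section \<open>Frequent hypercyclicity\<close>

lemma lower_density_pos:
  assumes "0 < q" and "\<forall>\<^sub>F N in sequentially. q * real N \<le> real (card {n. n < N \<and> n \<in> D})"
  shows "0 < lower_density D"
proof -
  have "\<forall>\<^sub>F N in sequentially. ereal q \<le> ereal (real (card {n. n \<le> N \<and> n \<in> D}) / real N)"
    using assms(2) eventually_gt_at_top[of 0]
  proof eventually_elim
    case (elim N)
    have "card {n. n < N \<and> n \<in> D} \<le> card {n. n \<le> N \<and> n \<in> D}" by (rule card_mono) auto
    then have "q * real N \<le> real (card {n. n \<le> N \<and> n \<in> D})" using elim by linarith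
    then show ?case using elim by (simp add: field_simps)
  qed
  then have "ereal q \<le> lower_density D" unfolding lower_density_def by (rule Liminf_bounded)
  then show ?thesis using assms(1) by (metis ereal_less(2) less_le_trans)
qed

lemma card_Int_UN_le_suminf:
  fixes c :: "nat \<Rightarrow> real"
  assumes "finite A" "\<And>j. real (card (A \<inter> B j)) \<le> c j" "summable c"
  shows "real (card (A \<inter> (\<Union>j. B j))) \<le> suminf c"
proof -
  have "\<forall>n\<in>A \<inter> (\<Union>j. B j). \<exists>j. n \<in> B j" by blast
  then obtain j where j: "\<And>n. n \<in> A \<inter> (\<Union>j. B j) \<Longrightarrow> n \<in> B (j n)" by metis
  define J where "J = j ` (A \<inter> (\<Union>j. B j))"
  have J: "finite J" unfolding J_def using assms(1) by simp
  have "card (A \<inter> (\<Union>j. B j)) \<le> card (\<Union>i\<in>J. A \<inter> B i)"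
    using assms(1) J j by (intro card_mono) (auto simp: J_def)
  also have "\<dots> \<le> (\<Sum>i\<in>J. card (A \<inter> B i))" by (rule card_UN_le[OF J])
  finally have "real (card (A \<inter> (\<Union>j. B j))) \<le> (\<Sum>i\<in>J. real (card (A \<inter> B i)))"
    by (metis of_nat_mono of_nat_sum)
  also have "\<dots> \<le> (\<Sum>i\<in>J. c i)" by (rule sum_mono) (rule assms(2))
  also have "\<dots> \<le> suminf c"
    using J assms(2,3) by (intro sum_le_suminf) (auto intro: order_trans[OF of_nat_0_le_iff])
  finally show ?thesis .
qed

text \<open>The doubled radius leaves room for the perturbation caused by the later steps.\<close>

lemma enumerate_targets:
  assumes "separable_space (euclidean :: 'a::real_normed_vector topology)"
  obtains w :: "nat \<Rightarrow> 'a::real_normed_vector" and r :: "nat \<Rightarrow> real" where "\<And>k. 0 < r k"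
    "\<And>U. open U \<Longrightarrow> U \<noteq> {} \<Longrightarrow> \<exists>k. ball (w k) (2 * r k) \<subseteq> U"
proof -
  obtain Q :: "'a set" where Q: "countable Q" "closure Q = UNIV"
    using assms unfolding separable_space_def by auto
  then have "Q \<noteq> {}" by auto
  define w where "w k = from_nat_into Q (fst (prod_decode k))" for k
  define r where "r k = inverse (real (Suc (snd (prod_decode k))))" for k
  show ?thesis
  proof (rule that[of r w])
    show "0 < r k" for k by (simp add: r_def)
  next
    fix U :: "'a set" assume "open U" "U \<noteq> {}"
    then obtain x e where x: "0 < e" "ball x e \<subseteq> U" by (meson openE ex_in_conv)
    obtain n where n: "inverse (real (Suc n)) < e/4"
      using reals_Archimedean[of "e/4"] x(1) by auto
    have "x \<in> closure Q" using Q(2) by simp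
    then obtain q where q: "q \<in> Q" "dist q x < e/2" unfolding closure_approachable using x(1) half_gt_zero by blast
    obtain i where i: "from_nat_into Q i = q" using from_nat_into_surj[OF Q(1) q(1)] by blast
    have "ball q (2 * inverse (real (Suc n))) \<subseteq> ball x e"
    proof
      fix v assume "v \<in> ball q (2 * inverse (real (Suc n)))"
      then have "dist x v < e" using dist_triangle[of x v q] q(2) n by (simp add: dist_commute)
      then show "v \<in> ball x e" by simp
    qed
    then show "\<exists>k. ball (w k) (2 * r k) \<subseteq> U"
      using x(2) i by (intro exI[of _ "prod_encode (i, n)"]) (auto simp: w_def r_def)
  qed
qed

context bounded_clinear_operator begin

text \<open>The partial sums \<open>z k\<close> are chosen together with error bounds \<open>e k\<close>: the orbit of the
  \<open>k\<close>-th perturbation stays below \<open>e k\<close> except at times of frequency at most \<open>e k\<close>. Each bound is at most half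
  of its predecessor and is small compared with the radius and the hitting density of the targets
  treated before, so that the sum of all later bounds, at most twice the first of them, still is.\<close>

lemma frequently_hypercyclic_if_rarely_large_limits:
  assumes separable: "separable_space (euclidean :: 'a topology)"
    and all: "rarely_large_limits = UNIV"
  shows "frequently_hypercyclic T"
proof -
  obtain w :: "nat \<Rightarrow> 'a" and r :: "nat \<Rightarrow> real" where r: "\<And>k. 0 < r k"
    and targets: "\<And>U. open U \<Longrightarrow> U \<noteq> {} \<Longrightarrow> \<exists>k. ball (w k) (2 * r k) \<subseteq> U"
    by (rule enumerate_targets[OF separable]) (rule that)
  \<comment> \<open>A state is a pair of a partial sum and the error bound for the next perturbation.\<close>
  define adm where "adm s \<longleftrightarrow> fst s \<in> unimodular_span T \<and> 0 < snd s \<and> snd s \<le> 1/2" for s :: "'a \<times> real"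
  define succ where "succ k s s' \<longleftrightarrow> (\<exists>p>0.
      (\<forall>N. real (card {n. n < N \<and> snd s \<le> norm ((T ^^ n) (fst s' - fst s))}) \<le> snd s * real N) \<and>
      (\<forall>\<^sub>F N in sequentially. p * real N \<le> real (card {n. n < N \<and> norm ((T ^^ n) (fst s') - w k) < r k})) \<and>
      snd s' \<le> snd s / 2 \<and> snd s' \<le> r k / 2 \<and> snd s' \<le> p / 4)" for k and s s' :: "'a \<times> real"
  have "\<exists>s. \<forall>k. adm (s k) \<and> succ k (s k) (s (Suc k))"
  proof (rule dependent_nat_choice)
    show "\<exists>s. adm s"
      using complex_vector.subspace_0[OF unimodular_span_subspace]
      by (intro exI[of _ "(0, 1/2)"]) (simp add: adm_def)
  next
    fix s k assume s: "adm s"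
    then have s': "fst s \<in> unimodular_span T" "0 < snd s" unfolding adm_def by auto
    obtain y p where y: "y \<in> unimodular_span T" "0 < p"
      "\<forall>N. real (card {n. n < N \<and> snd s \<le> norm ((T ^^ n) y)}) \<le> snd s * real N"
      "\<forall>\<^sub>F N in sequentially. p * real N \<le> real (card {n. n < N \<and> norm ((T ^^ n) (fst s + y) - w k) < r k})"
      using exists_perturbation[OF all s'(1) r[of k] s'(2), of "w k"] by blast
    have "adm (fst s + y, min (snd s / 2) (min (r k / 2) (p / 4)))"
      using s y(1,2) r[of k] complex_vector.subspace_add[OF unimodular_span_subspace]
      unfolding adm_def by auto
    moreover have "succ k s (fst s + y, min (snd s / 2) (min (r k / 2) (p / 4)))"
      unfolding succ_def using y by (intro exI[of _ p]) auto
    ultimately show "\<exists>s'. adm s' \<and> succ k s s'" by blast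
  qed
  then obtain s where adm: "\<And>k. adm (s k)" and succ: "\<And>k. succ k (s k) (s (Suc k))" by blast
  define z where "z k = fst (s k)" for k
  define e where "e k = snd (s k)" for k
  have e: "0 < e k" "e k \<le> 1/2" for k using adm unfolding adm_def e_def by auto
  have e_half: "e (Suc k) \<le> e k / 2" and e_r: "2 * e (Suc k) \<le> r k"
    and rare: "real (card {n. n < N \<and> e k \<le> norm ((T ^^ n) (z (Suc k) - z k))}) \<le> e k * real N" for k N
    using succ[of k] unfolding succ_def e_def z_def by auto
  have hits: "\<exists>p. 4 * e (Suc k) \<le> p \<and> (\<forall>\<^sub>F N in sequentially.
      p * real N \<le> real (card {n. n < N \<and> norm ((T ^^ n) (z (Suc k)) - w k) < r k}))" for k
  proof -
    obtain p where p: "e (Suc k) \<le> p / 4" "\<forall>\<^sub>F N in sequentially.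
        p * real N \<le> real (card {n. n < N \<and> norm ((T ^^ n) (z (Suc k)) - w k) < r k})"
      using succ[of k] unfolding succ_def e_def z_def by blast
    then show ?thesis by (intro exI[of _ p]) simp
  qed
  have e_geo: "e (k + j) \<le> e k * (1/2) ^ j" for k j
  proof (induction j)
    case (Suc j)
    then show ?case using e_half[of "k + j"] by simp
  qed simp
  have geo: "(\<lambda>j. c * (1/2) ^ j) sums (2 * c)" for c :: real
    using sums_mult[OF geometric_sums[of "1/2 :: real"], of c] by (simp add: mult.commute)
  define y where "y k = z (Suc k) - z k" for k
  have y_small: "norm (y k) < e k" for k
  proof (rule ccontr)
    assume "\<not> norm (y k) < e k"
    then have "{n. n < 1 \<and> e k \<le> norm ((T ^^ n) (z (Suc k) - z k))} = {0}" by (auto simp: y_def)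
    then show False using rare[of 1 k] e(2)[of k] by simp
  qed
  have "summable y"
  proof (rule summable_comparison_test)
    have "norm (y k) \<le> e 0 * (1/2) ^ k" for k using y_small[of k] e_geo[of 0 k] by simp
    then show "\<exists>N. \<forall>n\<ge>N. norm (y n) \<le> e 0 * (1/2) ^ n" by blast
    show "summable (\<lambda>k. e 0 * (1/2) ^ k)" using geo by (rule sums_summable)
  qed
  then have "(\<lambda>n. \<Sum>k<n. y k) \<longlonglongrightarrow> suminf y" by (rule summable_LIMSEQ)
  then have "(\<lambda>n. z n - z 0) \<longlonglongrightarrow> suminf y" unfolding y_def by (simp add: sum_lessThan_telescope)
  then have "(\<lambda>n. (z n - z 0) + z 0) \<longlonglongrightarrow> suminf y + z 0" by (intro tendsto_add tendsto_const)
  then obtain x where x: "z \<longlonglongrightarrow> x" by auto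
  define bad where "bad k = (\<Union>j. {n. e (k + j) \<le> norm ((T ^^ n) (y (k + j)))})" for k
  have close: "norm ((T ^^ n) x - (T ^^ n) (z k)) \<le> 2 * e k" if n: "n \<notin> bad k" for n k
  proof -
    have "(\<lambda>j. z (k + j)) \<longlonglongrightarrow> x"
      using LIMSEQ_ignore_initial_segment[OF x, of k] by (simp add: add.commute)
    then have "(\<lambda>j. y (k + j)) sums (x - z k)" unfolding y_def using telescope_sums by fastforce
    then have "(\<lambda>j. (T ^^ n) (y (k + j))) sums (T ^^ n) (x - z k)" by (rule power.sums)
    then have eq: "(T ^^ n) x - (T ^^ n) (z k) = (\<Sum>j. (T ^^ n) (y (k + j)))"
      by (simp add: power.diff sums_iff)
    have "norm ((T ^^ n) (y (k + j))) \<le> e k * (1/2) ^ j" for j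
    proof -
      have "norm ((T ^^ n) (y (k + j))) < e (k + j)"
        using n unfolding bad_def UN_iff mem_Collect_eq not_le[symmetric] by blast
      then show ?thesis using e_geo[of k j] by linarith
    qed
    then have "norm (\<Sum>j. (T ^^ n) (y (k + j))) \<le> (\<Sum>j. e k * (1/2) ^ j)"
      by (rule norm_suminf_le) (rule sums_summable[OF geo])
    then show ?thesis unfolding eq using sums_unique[OF geo[of "e k"]] by simp
  qed
  have bad_card: "real (card ({..<N} \<inter> bad k)) \<le> 2 * (e k * real N)" for N k
  proof -
    have "real (card ({..<N} \<inter> bad k)) \<le> (\<Sum>j. e k * real N * (1/2) ^ j)"
      unfolding bad_def
    proof (rule card_Int_UN_le_suminf)
      fix j
      have "{..<N} \<inter> {n. e (k + j) \<le> norm ((T ^^ n) (y (k + j)))}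
          = {n. n < N \<and> e (k + j) \<le> norm ((T ^^ n) (z (Suc (k + j)) - z (k + j)))}"
        by (auto simp: y_def)
      then have "real (card ({..<N} \<inter> {n. e (k + j) \<le> norm ((T ^^ n) (y (k + j)))})) \<le> e (k + j) * real N"
        using rare[of N "k + j"] by simp
      also have "\<dots> \<le> e k * (1/2) ^ j * real N" by (rule mult_right_mono[OF e_geo]) simp
      finally show "real (card ({..<N} \<inter> {n. e (k + j) \<le> norm ((T ^^ n) (y (k + j)))})) \<le> e k * real N * (1/2) ^ j"
        by (simp add: mult_ac)
    qed (simp_all add: sums_summable[OF geo])
    then show ?thesis using sums_unique[OF geo[of "e k * real N"]] by simp
  qed
  show ?thesis
    unfolding frequently_hypercyclic_def
  proof (intro exI[of _ x] allI impI)
    fix U :: "'a set" assume U: "open U \<and> U \<noteq> {}"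
    then obtain k where k: "ball (w k) (2 * r k) \<subseteq> U" using targets by blast
    obtain p where p: "4 * e (Suc k) \<le> p" and
      hit: "\<forall>\<^sub>F N in sequentially. p * real N \<le> real (card {n. n < N \<and> norm ((T ^^ n) (z (Suc k)) - w k) < r k})"
      using hits by blast
    show "0 < lower_density {n. (T ^^ n) x \<in> U}"
    proof (rule lower_density_pos)
      show "0 < 2 * e (Suc k)" using e by simp
      show "\<forall>\<^sub>F N in sequentially. 2 * e (Suc k) * real N \<le> real (card {n. n < N \<and> n \<in> {n. (T ^^ n) x \<in> U}})"
        using hit
      proof eventually_elim
        case (elim N)
        let ?H = "{n. n < N \<and> norm ((T ^^ n) (z (Suc k)) - w k) < r k}" and ?U = "{n. n < N \<and> n \<in> {n. (T ^^ n) x \<in> U}}"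
        have "?H \<subseteq> ?U \<union> ({..<N} \<inter> bad (Suc k))"
        proof
          fix n assume n: "n \<in> ?H"
          have "(T ^^ n) x \<in> U" if "n \<notin> bad (Suc k)"
          proof -
            have "norm ((T ^^ n) x - (T ^^ n) (z (Suc k))) \<le> r k"
              using close[OF that] e_r[of k] by simp
            then have "norm ((T ^^ n) x - w k) < 2 * r k"
              using n norm_triangle_ineq[of "(T ^^ n) x - (T ^^ n) (z (Suc k))" "(T ^^ n) (z (Suc k)) - w k"]
              by simp
            then show ?thesis using k by (auto simp: dist_norm norm_minus_commute)
          qed
          then show "n \<in> ?U \<union> ({..<N} \<inter> bad (Suc k))" using n by auto
        qed
        then have "card ?H \<le> card (?U \<union> ({..<N} \<inter> bad (Suc k)))" by (rule card_mono[rotated]) simp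
        also have "\<dots> \<le> card ?U + card ({..<N} \<inter> bad (Suc k))" by (rule card_Un_le)
        finally have "p * real N \<le> real (card ?U) + 2 * (e (Suc k) * real N)"
          using elim bad_card[of N "Suc k"] by linarith
        moreover have "4 * e (Suc k) * real N \<le> p * real N" using p by (rule mult_right_mono) simp
        ultimately show ?case by simp
      qed
    qed
  qed
qed

end

theorem theorem1p4:
  fixes T :: "'a::cbanach \<Rightarrow> 'a"
  assumes "separable_space (euclidean :: 'a topology)"
    and "\<not> cfinite_dim TYPE('a)"
    and "bounded_clinear T"
    and "perfectly_spanning_unimodular T"
  shows "frequently_hypercyclic T"
proof -
  interpret bounded_clinear_operator T by unfold_locales fact
  have all: "rarely_large_limits = UNIV"
  proof -
    obtain D where D: "countable D"
      "\<And>z u e. z \<in> unit_circle - D \<Longrightarrow> u \<in> eigenspace T z \<Longrightarrow> 0 < e \<Longrightarrow>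
        infinite {\<mu> \<in> unit_circle. eigenspace T \<mu> \<inter> ball u e \<noteq> {}}"
      using countable_few_nearby_eigenvalues[OF assms(1)] by blast
    have "(\<Union>z\<in>unit_circle - D. eigenspace T z) \<subseteq> rarely_large_limits"
      using accumulated_eigenvector_rarely_large_limit D(2) by blast
    then have "cspan (\<Union>z\<in>unit_circle - D. eigenspace T z) \<subseteq> rarely_large_limits"
      using subspace_rarely_large_limits by (rule complex_vector.span_minimal)
    then have "closure (cspan (\<Union>z\<in>unit_circle - D. eigenspace T z)) \<subseteq> rarely_large_limits"
      using closed_rarely_large_limits by (rule closure_minimal)
    then show ?thesis using perfectly_spanning_off_countable[OF assms(4) D(1)] by blast
  qed
  show ?thesis by (rule frequently_hypercyclic_if_rarely_large_limits[OF assms(1) all])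
qed

end
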